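(* Let $v=(v_{12},v_{13},v_{14},v_{23},v_{24},v_{34})$ be a boundary point of the discrete Plücker set $\mathrm{Pl}_{4,2}(\mathbb{Z})$. Then there exist lattice segments $P_1,\dots,P_4$ in $\mathbb{R}^2$ (possibly degenerate to a point) such that $v_{ij}=V(P_i,P_j)$ for all $1\leq i<j\leq 4$.
   Context: A lattice segment in $\mathbb{R}^2$ is the convex hull of two points of $\mathbb{Z}^2$; if the two points coincide it is degenerate to a point. For lattice polytopes $P,Q$ in $\mathbb{R}^2$ (convex hulls of nonempty finite subsets of $\mathbb{Z}^2$), the normalized mixed area is $V(P,Q)=\frac12\left(\mathrm{Vol}_2(P+Q)-\mathrm{Vol}_2(P)-\mathrm{Vol}_2(Q)\right)$, where $P+Q$ is the Minkowski sum and $\mathrm{Vol}_2$ is twice the Euclidean area. Square-free quadratic forms $\sum_{1\le i<j\le 4}v_{ij}x_ix_j$ are identified with their coefficient vectors $v=(v_{ij})_{1\le i<j\le 4}$, with the convention $v_{ji}=v_{ij}$. The discrete Plücker set $\mathrm{Pl}_{4,2}(\mathbb{Z})$ is the set of all such $v$ with $v_{ij}\in\mathbb{Z}_{\geq 0}$ satisfying the three Plücker-type inequalities $$v_{12}v_{34}+v_{13}v_{24}\geq v_{14}v_{23},\quad v_{13}v_{24}+v_{14}v_{23}\geq v_{12}v_{34},\quad v_{14}v_{23}+v_{12}v_{34}\geq v_{13}v_{24}.$$ A point $v\in\mathrm{Pl}_{4,2}(\mathbb{Z})$ is a boundary point if at least one of these three inequalities is an equality at $v$; otherwise it is an interior point.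 *)

theory Defs
  imports "HOL-Analysis.Analysis" "HOL-Library.Set_Algebras"
begin

definition lattice_points :: "(real ^ 2) set" where
  "lattice_points = {x. \<forall>k. x $ k \<in> \<int>}"

text \<open>The two end points may coincide, so single lattice points are lattice segments.\<close>

definition lattice_segment :: "(real ^ 2) set \<Rightarrow> bool" where
  "lattice_segment P \<longleftrightarrow>
     (\<exists>a\<in>lattice_points. \<exists>b\<in>lattice_points. P = convex hull {a, b})"

definition Vol2 :: "(real ^ 2) set \<Rightarrow> real" where
  "Vol2 S = 2 * measure lebesgue S"

text \<open>
  The sum of sets below is the Minkowski sum. The mixed area is meant for lattice polytopes;
  the formula is used for arbitrary sets only because functions are total.
\<close>

definition mixed_area :: "(real ^ 2) set \<Rightarrow> (real ^ 2) set \<Rightarrow> real" where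
  "mixed_area P Q = (Vol2 (P + Q) - Vol2 P - Vol2 Q) / 2"

text \<open>
  A coefficient vector, indexed by the pairs i < j in {1..4}, is a function on pairs of natural
  numbers of which only these six values are ever used; all other values are
  unconstrained.
\<close>

definition Pl42 :: "(nat \<Rightarrow> nat \<Rightarrow> int) set" where
  "Pl42 = {v.
     (\<forall>i j. 1 \<le> i \<and> i < j \<and> j \<le> 4 \<longrightarrow> 0 \<le> v i j) \<and>
     v 1 2 * v 3 4 + v 1 3 * v 2 4 \<ge> v 1 4 * v 2 3 \<and>
     v 1 3 * v 2 4 + v 1 4 * v 2 3 \<ge> v 1 2 * v 3 4 \<and>
     v 1 4 * v 2 3 + v 1 2 * v 3 4 \<ge> v 1 3 * v 2 4}"

definition Pl42_boundary :: "(nat \<Rightarrow> nat \<Rightarrow> int) set" where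
  "Pl42_boundary = {v \<in> Pl42.
     v 1 2 * v 3 4 + v 1 3 * v 2 4 = v 1 4 * v 2 3 \<or>
     v 1 3 * v 2 4 + v 1 4 * v 2 3 = v 1 2 * v 3 4 \<or>
     v 1 4 * v 2 3 + v 1 2 * v 3 4 = v 1 3 * v 2 4}"

end

theory Submission
  imports Defs
begin

text \<open>
  The mixed area of the segments from 0 to p and from 0 to q is the absolute value of det (p, q),
  so what is needed is four integer vectors with prescribed absolute 2 x 2 minors. Equality in
  one of the three inequalities says that, after suitable sign changes, v satisfies the Pluecker
  relation, i.e. is a decomposable integral bivector; such a bivector is a wedge product of two
  integer vectors. These are found explicitly: writing the first row of v as a multiple of a
  primitive vector y with \<open>u \<bullet> y = 1\<close>, the remaining coordinates solve \<open>x \<times> y = w\<close>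
  with \<open>w \<bullet> y = 0\<close>, and \<open>x = u \<times> w\<close> is a solution.
\<close>

lemma convex_hull_zero_insert:
  fixes p :: "'a::real_vector"
  shows "convex hull {0, p} = (\<lambda>t. t *\<^sub>R p) ` {0..1}"
  by (force simp: segment_convex_hull[symmetric] in_segment image_def)

text \<open>The sum is the image of the unit square under the linear map with columns
  \<open>p\<close> and \<open>q\<close>, which scales measure by the absolute value of its
  determinant.\<close>

lemma measure_parallelogram:
  fixes p q :: "real ^ 2"
  shows "measure lebesgue (convex hull {0, p} + convex hull {0, q}) =
           \<bar>p $ 1 * q $ 2 - p $ 2 * q $ 1\<bar>"
proof -
  define f :: "real ^ 2 \<Rightarrow> real ^ 2" where "f = (\<lambda>z. z $ 1 *\<^sub>R p + z $ 2 *\<^sub>R q)"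
  have lin: "linear f"
    by (rule linearI) (auto simp: f_def algebra_simps)
  have "convex hull {0, p} + convex hull {0, q} = f ` cbox 0 1" (is "?L = ?R")
  proof
    show "?L \<subseteq> ?R"
    proof
      fix z assume "z \<in> ?L"
      then obtain s t where st: "s \<in> {0..1}" "t \<in> {0..1}" "z = s *\<^sub>R p + t *\<^sub>R q"
        by (auto simp: convex_hull_zero_insert set_plus_def)
      then have "z = f (vector [s, t])" "vector [s, t] \<in> cbox 0 (1 :: real ^ 2)"
        by (auto simp: f_def mem_box_cart forall_2)
      then show "z \<in> ?R" by blast
    qed
    show "?R \<subseteq> ?L"
      by (auto simp: convex_hull_zero_insert f_def mem_box_cart forall_2 intro!: set_plus_intro)
  qed
  moreover have "measure lebesgue (cbox 0 (1 :: real ^ 2)) = 1"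
    by (simp add: content_cbox_if_cart measure_completion interval_ne_empty_cart)
  moreover have "det (matrix f) = p $ 1 * q $ 2 - p $ 2 * q $ 1"
    by (simp add: det_2 matrix_def f_def axis_def)
  ultimately show ?thesis
    using measure_linear_image[OF lin, of "cbox 0 1"] by simp
qed

lemma mixed_area_segments:
  fixes p q :: "real ^ 2"
  shows "mixed_area (convex hull {0, p}) (convex hull {0, q}) = \<bar>p $ 1 * q $ 2 - p $ 2 * q $ 1\<bar>"
proof -
  have "measure lebesgue (convex hull {0, r}) = 0" for r :: "real ^ 2"
    \<comment> \<open>A segment is a parallelogram with second side 0, so its determinant
      vanishes.\<close>
    using measure_parallelogram[of r 0] by (simp add: set_plus_def)
  then show ?thesis
    by (simp add: mixed_area_def Vol2_def measure_parallelogram)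
qed

text \<open>If (a, b, c) is nonzero, \<open>g\<close> is its gcd, \<open>u\<close> comes from
  Bezout, and cancelling \<open>g\<close> in the hypothesis gives the orthogonality. If it is zero,
  the hypothesis says nothing about \<open>y\<close>, and a primitive vector orthogonal to (f, -e,
  d) is chosen by hand.\<close>

lemma primitive_multiple:
  fixes a b c d e f :: int
  assumes "a * f - b * e + c * d = 0"
  obtains g y2 y3 y4 u2 u3 u4 :: int
  where "a = g * y2" "b = g * y3" "c = g * y4" "u2 * y2 + u3 * y3 + u4 * y4 = 1"
    "f * y2 - e * y3 + d * y4 = 0"
proof (cases "a = 0 \<and> b = 0 \<and> c = 0")
  case True
  show thesis
  proof (cases "e = 0 \<and> f = 0")
    case zero: True
    then show thesis using True that[of 0 1 0 0 1 0 0] by simp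
  next
    case False
    define h where "h = gcd e f"
    have "h \<noteq> 0" using False by (simp add: h_def)
    obtain r s where rs: "e = h * r" "f = h * s"
      unfolding h_def by (meson gcd_dvd1 gcd_dvd2 dvdE)
    obtain k l where "k * e + l * f = h"
      unfolding h_def using bezout_int by blast
    then have "h * (k * r + l * s) = h * 1" by (simp add: rs algebra_simps)
    then have "k * r + l * s = 1" using \<open>h \<noteq> 0\<close> by simp
    \<comment> \<open>With \<open>y\<close> = (r, s, 0), orthogonality reads
      \<open>h * s * r - h * r * s = 0\<close>.\<close>
    then show thesis using True that[of 0 r s 0 k l 0] by (simp add: rs)
  qed
next
  case False
  define g where "g = gcd (gcd a b) c"
  have "g \<noteq> 0" using False by (simp add: g_def)
  have "g dvd a" "g dvd b" "g dvd c"
    unfolding g_def by (auto intro: dvd_trans)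
  then obtain y2 y3 y4 where y: "a = g * y2" "b = g * y3" "c = g * y4"
    by (auto elim!: dvdE)
  obtain k l where kl: "k * a + l * b = gcd a b" using bezout_int by blast
  obtain m n where mn: "m * gcd a b + n * c = g" unfolding g_def using bezout_int by blast
  have "g * (m * k * y2 + m * l * y3 + n * y4) = m * (k * a + l * b) + n * c"
    by (simp add: y algebra_simps)
  also have "\<dots> = g * 1" using kl mn by simp
  finally have "m * k * y2 + m * l * y3 + n * y4 = 1" using \<open>g \<noteq> 0\<close> by simp
  moreover have "g * (f * y2 - e * y3 + d * y4) = 0"
    using assms by (simp add: y algebra_simps)
  ultimately show thesis using that[OF y] \<open>g \<noteq> 0\<close> by simp
qed

lemma plucker_relation_integral_minors:
  fixes a b c d e f :: int
  assumes "a * f - b * e + c * d = 0"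
  obtains x1 x2 x3 x4 y1 y2 y3 y4 :: int
  where "x1 * y2 - y1 * x2 = a" "x1 * y3 - y1 * x3 = b" "x1 * y4 - y1 * x4 = c"
    "x2 * y3 - y2 * x3 = d" "x2 * y4 - y2 * x4 = e" "x3 * y4 - y3 * x4 = f"
proof -
  obtain g y2 y3 y4 u2 u3 u4
    where y: "a = g * y2" "b = g * y3" "c = g * y4"
      and u: "u2 * y2 + u3 * y3 + u4 * y4 = 1"
      and w: "f * y2 - e * y3 + d * y4 = 0"
    using primitive_multiple[OF assms] .
  \<comment> \<open>This is \<open>u \<times> w\<close> for w = (f, -e, d); by the triple product
    expansion, its cross product with \<open>y\<close> is w (u . y) - u (w . y) = w.\<close>
  define x2 x3 x4 where x: "x2 = u3 * d + u4 * e" "x3 = u4 * f - u2 * d" "x4 = - u2 * e - u3 * f"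
  have "x2 * y3 - y2 * x3 = d" "x2 * y4 - y2 * x4 = e" "x3 * y4 - y3 * x4 = f"
    unfolding x using u w by algebra+
  \<comment> \<open>Taking \<open>x1 = g\<close> and \<open>y1 = 0\<close> turns the first-row
    minors into \<open>g * y2\<close>, \<open>g * y3\<close>, \<open>g * y4\<close>.\<close>
  then show thesis using that[of g y2 0 x2 y3 x3 y4 x4] y by simp
qed

theorem theorem6p2:
  fixes v :: "nat \<Rightarrow> nat \<Rightarrow> int"
  assumes "v \<in> Pl42_boundary"
  shows "\<exists>P :: nat \<Rightarrow> (real ^ 2) set.
           (\<forall>i\<in>{1..4}. lattice_segment (P i)) \<and>
           (\<forall>i j. 1 \<le> i \<and> i < j \<and> j \<le> 4 \<longrightarrow>
              real_of_int (v i j) = mixed_area (P i) (P j))"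
proof -
  have nonneg: "0 \<le> v i j" if "1 \<le> i" "i < j" "j \<le> 4" for i j
    using assms that by (simp add: Pl42_boundary_def Pl42_def)
  \<comment> \<open>Signs on \<open>v 1 3\<close> and \<open>v 1 4\<close> alone bring each of the
    three equalities into Pluecker form.\<close>
  obtain s t :: int where st: "s \<in> {1, -1}" "t \<in> {1, -1}"
    "v 1 2 * v 3 4 - (s * v 1 3) * v 2 4 + (t * v 1 4) * v 2 3 = 0"
  proof -
    consider "v 1 2 * v 3 4 + v 1 3 * v 2 4 = v 1 4 * v 2 3"
      | "v 1 3 * v 2 4 + v 1 4 * v 2 3 = v 1 2 * v 3 4"
      | "v 1 4 * v 2 3 + v 1 2 * v 3 4 = v 1 3 * v 2 4"
      using assms by (auto simp: Pl42_boundary_def)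
    then show thesis
    proof cases
      case 1 then show thesis using that[of "-1" "-1"] by simp
    next
      case 2 then show thesis using that[of 1 "-1"] by simp
    next
      case 3 then show thesis using that[of 1 1] by simp
    qed
  qed
  obtain x1 x2 x3 x4 y1 y2 y3 y4 where
    minors: "x1 * y2 - y1 * x2 = v 1 2" "x1 * y3 - y1 * x3 = s * v 1 3"
      "x1 * y4 - y1 * x4 = t * v 1 4" "x2 * y3 - y2 * x3 = v 2 3"
      "x2 * y4 - y2 * x4 = v 2 4" "x3 * y4 - y3 * x4 = v 3 4"
    using plucker_relation_integral_minors[OF st(3)] .
  define x where "x = (\<lambda>i::nat. if i = 1 then x1 else if i = 2 then x2 else if i = 3 then x3 else x4)"
  define y where "y = (\<lambda>i::nat. if i = 1 then y1 else if i = 2 then y2 else if i = 3 then y3 else y4)"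
  define p :: "nat \<Rightarrow> real ^ 2" where "p = (\<lambda>i. vector [of_int (x i), of_int (y i)])"
  have abs_minor: "v i j = \<bar>x i * y j - y i * x j\<bar>" if "1 \<le> i" "i < j" "j \<le> 4" for i j
  proof -
    have "(i, j) \<in> {(1,2), (1,3), (1,4), (2,3), (2,4), (3,4)}"
      using that by auto
    \<comment> \<open>The signs disappear under absolute values, and the entries of \<open>v\<close>
      are nonnegative.\<close>
    moreover have "\<bar>s\<bar> = 1" "\<bar>t\<bar> = 1" using st by auto
    ultimately show ?thesis
      using nonneg[OF that] by (auto simp: x_def y_def minors abs_mult)
  qed
  have "lattice_segment (convex hull {0, p i})" for i
    unfolding lattice_segment_def
    by (intro bexI[of _ 0] bexI[of _ "p i"]) (auto simp: lattice_points_def p_def forall_2)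
  moreover have "real_of_int (v i j) = mixed_area (convex hull {0, p i}) (convex hull {0, p j})"
    if "1 \<le> i" "i < j" "j \<le> 4" for i j
    using abs_minor[OF that] by (simp add: mixed_area_segments p_def)
  ultimately show ?thesis by (intro exI[of _ "\<lambda>i. convex hull {0, p i}"]) blast
qed

end
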